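(* Let $X$ be a Banach space and let $K\subset X^*$ be weak$^*$-compact. Then $K$ has summable Szlenk index if and only if $\overline{\mathrm{abs\,co}}^{\mathrm{weak}^*}(K)$ has summable Szlenk index.
   Context: The scalar field $\mathbb{K}$ is $\mathbb{R}$ or $\mathbb{C}$. $\overline{\mathrm{abs\,co}}^{\mathrm{weak}^*}(K)$ denotes the weak$^*$-closed, absolutely convex hull of $K$. For a weak$^*$-compact $K\subset X^*$ and $\varepsilon>0$, $s_\varepsilon(K)$ denotes the set of those $x^*\in K$ such that $\mathrm{diam}(V\cap K)>\varepsilon$ (norm diameter) for every weak$^*$-neighborhood $V$ of $x^*$; for $\varepsilon\leqslant 0$, $s_\varepsilon(K)=K$. For $M\geqslant 0$, $K$ has $M$-summable Szlenk index if whenever $n\in\mathbb{N}$ and $\varepsilon_1,\ldots,\varepsilon_n\in\mathbb{R}$ (equivalently, $\varepsilon_1,\ldots,\varepsilon_n>0$) are such that $s_{\varepsilon_1}\cdots s_{\varepsilon_n}(K)\neq\varnothing$ (composition of derivations, $s_{\varepsilon_n}$ applied first), then $\sum_{i=1}^n\varepsilon_i\leqslant M$. $K$ has summable Szlenk index if it has $M$-summable Szlenk index for some $M\geqslant 0$. *)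

theory Defs
  imports "HOL-Analysis.Analysis"
begin

text \<open>
  The scalar field is \<open>\<real>\<close> or \<open>\<complex>\<close>. The class axiom says that a \<open>real_normed_field\<close> is either \<open>\<real>\<close>
  itself or \<open>\<real> + \<real>\<i>\<close> with \<open>\<i>\<^sup>2 = -1\<close> and the usual absolute value, so that up to isometric
  isomorphism \<open>real\<close> and \<open>complex\<close> are the only instances.
\<close>

class real_or_complex_field = real_normed_field +
  assumes real_or_complex:
    "(\<forall>z. \<exists>a. z = a *\<^sub>R 1) \<or>
     (\<exists>i. i * i = - 1 \<and>
       (\<forall>z. \<exists>a b. z = a *\<^sub>R 1 + b *\<^sub>R i \<and> norm z = sqrt (a\<^sup>2 + b\<^sup>2)))"

instance real :: real_or_complex_field
  by standard simp

instance complex :: real_or_complex_field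
proof (standard, rule disjI2, intro exI conjI allI)
  show "\<i> * \<i> = - 1" by simp
  fix z :: complex
  show "z = Re z *\<^sub>R 1 + Im z *\<^sub>R \<i>" by (simp add: complex_eq_iff)
  show "norm z = sqrt ((Re z)\<^sup>2 + (Im z)\<^sup>2)" by (simp add: cmod_def)
qed

text \<open>
  A Banach space over \<open>'k\<close>: the type \<open>'a\<close> carries the complete norm and the underlying real
  structure, and \<open>smul\<close> is the multiplication by scalars from \<open>'k\<close>, which extends \<open>scaleR\<close>.
\<close>

locale banach_space_over = vector_space smul
  for smul :: "'k::real_or_complex_field \<Rightarrow> 'a::banach \<Rightarrow> 'a" +
  assumes smul_of_real: "smul (of_real r) x = r *\<^sub>R x"
    and norm_smul: "norm (smul c x) = norm c * norm x"

lemma banach_space_over_scaleR: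
  "banach_space_over ((*\<^sub>R) :: real \<Rightarrow> 'a::banach \<Rightarrow> 'a)"
  by standard (simp_all add: algebra_simps)

lemma banach_space_over_complex:
  "banach_space_over ((*) :: complex \<Rightarrow> complex \<Rightarrow> complex)"
  by standard (simp_all add: algebra_simps norm_mult scaleR_conv_of_real)

text \<open>
  Elements of \<open>X\<^sup>*\<close> are the bounded real-linear maps \<open>X \<rightarrow> \<K>\<close> that are linear over \<open>\<K>\<close>. The type of
  bounded linear maps supplies the dual (operator) norm.
\<close>

definition dual_space ::
    "('k::real_or_complex_field \<Rightarrow> 'a::banach \<Rightarrow> 'a) \<Rightarrow> ('a \<Rightarrow>\<^sub>L 'k) set" where
  "dual_space smul = {f. Vector_Spaces.linear smul (*) (blinfun_apply f)}"

text \<open>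
  For bounded linear maps into the scalar field, the strong operator topology is the topology of
  pointwise convergence on \<open>X\<close>.
\<close>

definition weak_star ::
    "('k::real_or_complex_field \<Rightarrow> 'a::banach \<Rightarrow> 'a) \<Rightarrow> ('a \<Rightarrow>\<^sub>L 'k) topology" where
  "weak_star smul = subtopology strong_operator_topology (dual_space smul)"

definition balanced :: "('a::real_normed_vector \<Rightarrow>\<^sub>L 'k::real_normed_field) set \<Rightarrow> bool" where
  "balanced S \<longleftrightarrow> (\<forall>c. \<forall>f\<in>S. norm c \<le> 1 \<longrightarrow> blinfun_mult_right c o\<^sub>L f \<in> S)"

definition absolutely_convex ::
    "('a::real_normed_vector \<Rightarrow>\<^sub>L 'k::real_normed_field) set \<Rightarrow> bool" where
  "absolutely_convex S \<longleftrightarrow> convex S \<and> balanced S"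

definition weak_star_closed_abs_co ::
    "('k::real_or_complex_field \<Rightarrow> 'a::banach \<Rightarrow> 'a) \<Rightarrow> ('a \<Rightarrow>\<^sub>L 'k) set \<Rightarrow> ('a \<Rightarrow>\<^sub>L 'k) set" where
  "weak_star_closed_abs_co smul K = weak_star smul closure_of (absolutely_convex hull K)"

text \<open>
  The function \<open>diameter\<close> is meaningful on bounded sets only; weak*-compact sets are norm bounded
  because \<open>X\<close> is complete.
\<close>

definition szlenk_derivation ::
    "('k::real_or_complex_field \<Rightarrow> 'a::banach \<Rightarrow> 'a) \<Rightarrow> real \<Rightarrow> ('a \<Rightarrow>\<^sub>L 'k) set \<Rightarrow> ('a \<Rightarrow>\<^sub>L 'k) set" where
  "szlenk_derivation smul \<epsilon> K =
     (if \<epsilon> \<le> 0 then K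
      else {f \<in> K. \<forall>V. openin (weak_star smul) V \<and> f \<in> V \<longrightarrow> diameter (V \<inter> K) > \<epsilon>})"

text \<open>
  With \<open>\<epsilon>s = [\<epsilon>\<^sub>1, \<dots>, \<epsilon>\<^sub>n]\<close>, the \<open>foldr\<close> below is \<open>s\<close> for \<open>\<epsilon>\<^sub>1\<close> applied to \<dots> applied to \<open>s\<close> for
  \<open>\<epsilon>\<^sub>n\<close> of \<open>K\<close>. The empty list imposes no condition, as \<open>M \<ge> 0\<close>.
\<close>

definition M_summable_szlenk_index ::
    "('k::real_or_complex_field \<Rightarrow> 'a::banach \<Rightarrow> 'a) \<Rightarrow> real \<Rightarrow> ('a \<Rightarrow>\<^sub>L 'k) set \<Rightarrow> bool" where
  "M_summable_szlenk_index smul M K \<longleftrightarrow>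
     (\<forall>\<epsilon>s. foldr (szlenk_derivation smul) \<epsilon>s K \<noteq> {} \<longrightarrow> sum_list \<epsilon>s \<le> M)"

definition summable_szlenk_index ::
    "('k::real_or_complex_field \<Rightarrow> 'a::banach \<Rightarrow> 'a) \<Rightarrow> ('a \<Rightarrow>\<^sub>L 'k) set \<Rightarrow> bool" where
  "summable_szlenk_index smul K \<longleftrightarrow> (\<exists>M\<ge>0. M_summable_szlenk_index smul M K)"

end

theory Submission
  imports Defs
begin

text \<open>
  For a norm-bounded set \<open>K\<close> of functionals consider a game of \<open>n\<close> rounds: in each round one player
  chooses a weak neighbourhood of \<open>0\<close> in \<open>X\<close> and the other one a vector of the unit ball in it. If
  \<open>K\<close> is weak*-compact and has \<open>M\<close>-summable Szlenk index, then for every \<open>n\<close> the first player can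
  ensure \<open>sup\<^bsub>f\<in>K\<^esub> \<bar>f(x\<^sub>1 + \<dots> + x\<^sub>n)\<bar> \<le> M + 1\<close>. Conversely, if the first player can ensure the
  bound \<open>r\<close>, then \<open>K\<close> has \<open>5r\<close>-summable Szlenk index, because an element of the \<open>\<epsilon>\<close>-derivative can
  be perturbed to a functional that gains about \<open>\<epsilon>/4\<close> on a vector of the other player's choice.
  The supremum does not change when \<open>K\<close> is replaced by its weak*-closed absolutely convex hull.
\<close>


section \<open>Finite nets of the unit ball modulo finitely many functionals\<close>

text \<open>The ball is a closed subset of the continuous image of a square under
  \<open>(a, b) \<mapsto> a + b i\<close>, where \<open>i\<close> is an imaginary unit, or 0 if the
  field is real.\<close>

lemma compact_cball_scalar: "compact (cball (0::'k::real_or_complex_field) R)"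
proof -
  obtain i :: 'k where i: "\<And>z::'k. norm z \<le> R \<Longrightarrow>
      \<exists>a b. z = a *\<^sub>R 1 + b *\<^sub>R i \<and> \<bar>a\<bar> \<le> R \<and> \<bar>b\<bar> \<le> R"
    using real_or_complex
  proof
    assume "\<forall>z::'k. \<exists>a. z = a *\<^sub>R 1"
    then have "\<exists>a b. z = a *\<^sub>R 1 + b *\<^sub>R 0 \<and> \<bar>a\<bar> \<le> R \<and> \<bar>b\<bar> \<le> R" if "norm z \<le> R" for z :: 'k
    proof -
      obtain a where "z = a *\<^sub>R 1" using \<open>\<forall>z::'k. \<exists>a. z = a *\<^sub>R 1\<close> by blast
      then show ?thesis using that by (intro exI[of _ a] exI[of _ 0]) auto
    qed
    then show thesis by (rule that)
  next
    assume "\<exists>i::'k. i * i = - 1 \<and> (\<forall>z. \<exists>a b. z = a *\<^sub>R 1 + b *\<^sub>R i \<and> norm z = sqrt (a\<^sup>2 + b\<^sup>2))"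
    then obtain i :: 'k
      where i: "\<And>z. \<exists>a b. z = a *\<^sub>R 1 + b *\<^sub>R i \<and> norm z = sqrt (a\<^sup>2 + b\<^sup>2)" by blast
    have "\<exists>a b. z = a *\<^sub>R 1 + b *\<^sub>R i \<and> \<bar>a\<bar> \<le> R \<and> \<bar>b\<bar> \<le> R" if "norm z \<le> R" for z
      using i[of z] that real_sqrt_ge_abs1 real_sqrt_ge_abs2 by (metis order_trans)
    then show thesis by (rule that)
  qed
  let ?h = "\<lambda>(a, b). a *\<^sub>R 1 + b *\<^sub>R i"
  have "compact (?h ` ({-R..R} \<times> {-R..R}))"
    by (intro compact_continuous_image compact_Times compact_Icc)
      (auto simp: case_prod_unfold intro!: continuous_intros)
  moreover have "cball 0 R \<subseteq> ?h ` ({-R..R} \<times> {-R..R})"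
  proof
    fix z :: 'k assume "z \<in> cball 0 R"
    then obtain a b where "z = a *\<^sub>R 1 + b *\<^sub>R i" "\<bar>a\<bar> \<le> R" "\<bar>b\<bar> \<le> R"
      using i[of z] by auto
    then show "z \<in> ?h ` ({-R..R} \<times> {-R..R})"
      by (intro image_eqI[of _ _ "(a, b)"]) auto
  qed
  ultimately show ?thesis
    by (metis closed_cball compact_Int_closed inf.absorb_iff2)
qed

text \<open>Induction on \<open>F\<close>: a new \<open>g\<close> maps the unit ball into the
  compact disc of radius \<open>norm g\<close>. Finitely many discs of radius 1 cover it, and their
  preimages under \<open>g\<close> subdivide the old cells. Two points of one such disc are less
  than 2 apart.\<close>

lemma finite_unit_ball_cover:
  fixes F :: "('a::real_normed_vector \<Rightarrow>\<^sub>L 'k::real_or_complex_field) set"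
  assumes "finite F"
  shows "\<exists>\<C>. finite \<C> \<and> cball 0 1 \<subseteq> \<Union>\<C> \<and> (\<forall>C\<in>\<C>. \<forall>u\<in>C. \<forall>v\<in>C. \<forall>g\<in>F. norm (g u - g v) \<le> 2)"
  using assms
proof (induction F)
  case empty
  show ?case by (rule exI[of _ "{UNIV}"]) auto
next
  case (insert g F)
  then obtain \<C> where \<C>: "finite \<C>" "cball 0 1 \<subseteq> \<Union>\<C>"
    "\<And>C u v h. \<lbrakk>C \<in> \<C>; u \<in> C; v \<in> C; h \<in> F\<rbrakk> \<Longrightarrow> norm (h u - h v) \<le> 2"
    by metis
  obtain P where P: "finite P" "cball (0::'k) (norm g) \<subseteq> (\<Union>p\<in>P. ball p 1)"
    using compact_eq_totally_bounded[of "cball (0::'k) (norm g)"] compact_cball_scalar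
    by (metis zero_less_one)
  define \<D> where "\<D> = (\<lambda>(C, p). C \<inter> {u. g u \<in> ball p 1}) ` (\<C> \<times> P)"
  have "finite \<D>"
    unfolding \<D>_def using \<C>(1) P(1) by simp
  moreover have "cball 0 1 \<subseteq> \<Union>\<D>"
  proof
    fix z :: 'a assume z: "z \<in> cball 0 1"
    then obtain C where C: "C \<in> \<C>" "z \<in> C" using \<C>(2) by blast
    have "norm (g z) \<le> norm g"
      using norm_blinfun[of g z] z mult_left_le[of "norm z" "norm g"] by simp
    then obtain p where "p \<in> P" "g z \<in> ball p 1" using P(2) by auto
    with C show "z \<in> \<Union>\<D>" unfolding \<D>_def by force
  qed
  moreover have "norm (h u - h v) \<le> 2" if D: "D \<in> \<D>" "u \<in> D" "v \<in> D" and h: "h \<in> insert g F" for D u v h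
  proof (cases "h = g")
    case True
    obtain p where "dist p (g u) < 1" "dist p (g v) < 1"
      using D unfolding \<D>_def by auto
    then show ?thesis
      using True dist_triangle3[of "g u" "g v" p] by (simp add: dist_norm)
  next
    case False
    then show ?thesis using h D \<C>(3) unfolding \<D>_def by auto
  qed
  ultimately show ?case by (intro exI[of _ \<D>]) simp
qed

text \<open>One point of the unit ball is chosen in each cell that meets it. The bound 2 is what is
  needed for \<open>(z - w) / 2\<close> to lie in the unit ball and be bounded by 1 under every
  functional of \<open>F\<close>.\<close>

lemma finite_unit_ball_net:
  fixes F :: "('a::real_normed_vector \<Rightarrow>\<^sub>L 'k::real_or_complex_field) set"
  assumes "finite F"
  obtains Z where "finite Z" "\<And>z. z \<in> Z \<Longrightarrow> norm z \<le> 1"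
    "\<And>z. norm z \<le> 1 \<Longrightarrow> \<exists>w\<in>Z. \<forall>g\<in>F. norm (g (z - w)) \<le> 2"
proof -
  obtain \<C> where \<C>: "finite \<C>" "cball 0 1 \<subseteq> \<Union>\<C>"
    "\<And>C u v h. \<lbrakk>C \<in> \<C>; u \<in> C; v \<in> C; h \<in> F\<rbrakk> \<Longrightarrow> norm (h u - h v) \<le> 2"
    using finite_unit_ball_cover[OF assms] by metis
  define s where "s C = (SOME z. z \<in> C \<inter> cball 0 1)" for C :: "'a set"
  define Z where "Z = s ` {C \<in> \<C>. C \<inter> cball 0 1 \<noteq> {}}"
  have s: "s C \<in> C \<inter> cball 0 1" if "C \<inter> cball 0 1 \<noteq> {}" for C
    unfolding s_def using that by (meson ex_in_conv someI_ex)
  show thesis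
  proof (rule that)
    show "finite Z" unfolding Z_def using \<C>(1) by simp
    show "norm z \<le> 1" if "z \<in> Z" for z
      using that s unfolding Z_def by fastforce
    show "\<exists>w\<in>Z. \<forall>g\<in>F. norm (g (z - w)) \<le> 2" if "norm z \<le> 1" for z
    proof -
      have "z \<in> cball 0 1" using that by simp
      then obtain C where C: "C \<in> \<C>" "z \<in> C" using \<C>(2) by blast
      then have ne: "C \<inter> cball 0 1 \<noteq> {}" using that by auto
      have "\<forall>g\<in>F. norm (g (z - s C)) \<le> 2"
        using \<C>(3)[OF C] s[OF ne] by (simp add: blinfun.diff_right)
      moreover have "s C \<in> Z" unfolding Z_def using C ne by auto
      ultimately show ?thesis by blast
    qed
  qed
qed

section \<open>Uniform boundedness\<close>

text \<open>By Baire, one of the closed sets \<open>E n\<close> contains a ball of some radius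
  \<open>e\<close>. A vector of norm \<open>e / 2\<close> is a difference of two points of that
  ball, so every \<open>f\<close> in \<open>K\<close> is bounded by \<open>2 n\<close> on
  it.\<close>

lemma uniform_boundedness_principle:
  fixes K :: "('a::banach \<Rightarrow>\<^sub>L 'b::real_normed_vector) set"
  assumes "\<And>x. bounded ((\<lambda>f. blinfun_apply f x) ` K)"
  shows "bounded K"
proof -
  define E where "E n = {x. \<forall>f\<in>K. norm (blinfun_apply f x) \<le> real n}" for n
  have cl: "closed (E n)" for n
    unfolding E_def Collect_ball_eq
    by (intro closed_INT ballI closed_Collect_le continuous_intros)
  have un: "\<Union>(range E) = UNIV"
  proof -
    have "\<exists>n. x \<in> E n" for x
    proof -
      obtain B where B: "\<And>f. f \<in> K \<Longrightarrow> norm (blinfun_apply f x) \<le> B"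
        using assms[of x] unfolding bounded_iff by blast
      obtain n where "B \<le> real n" using real_arch_simple by blast
      then have "x \<in> E n" unfolding E_def using B by (auto intro: order_trans)
      then show ?thesis ..
    qed
    then show ?thesis by blast
  qed
  have "\<exists>n. interior (E n) \<noteq> {}"
  proof (rule ccontr)
    assume "\<not> ?thesis"
    then have "(euclidean :: 'a topology) interior_of \<Union>(range E) = {}"
      using cl by (intro Baire_category_alt) (auto simp: completely_metrizable_space_euclidean)
    then show False unfolding un by simp
  qed
  then obtain n a e where e: "e > 0" "ball a e \<subseteq> E n"
    by (metis ex_in_conv mem_interior)
  have "norm f \<le> 4 * real n / e" if f: "f \<in> K" for f
  proof (rule norm_blinfun_bound)
    show "0 \<le> 4 * real n / e" using e by simp
    fix x :: 'a
    show "norm (f x) \<le> 4 * real n / e * norm x"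
    proof (cases "x = 0")
      case False
      define t where "t = e / (2 * norm x)"
      have t: "t > 0" "norm (t *\<^sub>R x) = e / 2" using e False by (auto simp: t_def)
      have "a \<in> E n" "a + t *\<^sub>R x \<in> E n"
        using e t by (auto intro!: subsetD[OF e(2)] simp: dist_norm simp del: norm_scaleR)
      then have "norm (f a) \<le> n" "norm (f (a + t *\<^sub>R x)) \<le> n"
        using f unfolding E_def by auto
      moreover have "f (t *\<^sub>R x) = f (a + t *\<^sub>R x) - f a"
        by (simp add: blinfun.add_right)
      ultimately have "norm (f (t *\<^sub>R x)) \<le> 2 * real n"
        using norm_triangle_ineq4[of "f (a + t *\<^sub>R x)" "f a"] by simp
      then have "t * norm (f x) \<le> 2 * real n"
        using t by (simp add: blinfun.scaleR_right)
      then show ?thesis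
        using t e False by (simp add: t_def field_simps)
    qed simp
  qed
  then show ?thesis unfolding bounded_iff by blast
qed

section \<open>The weak* topology\<close>

lemma topspace_weak_star: "topspace (weak_star smul) = dual_space smul"
  by (simp add: weak_star_def strong_operator_topology_topspace)

lemma continuous_map_weak_star_eval:
  "continuous_map (weak_star smul) euclidean (\<lambda>f. blinfun_apply f x)"
  unfolding weak_star_def
  by (intro continuous_map_from_subtopology strong_operator_topology_continuous_evaluation)

lemma openin_weak_star_near:
  "openin (weak_star smul) {h \<in> dual_space smul. norm (blinfun_apply h x - c) < e}"
proof -
  have "openin (weak_star smul) {h \<in> topspace (weak_star smul). blinfun_apply h x \<in> ball c e}"
    by (intro openin_continuous_map_preimage[OF continuous_map_weak_star_eval]) auto
  moreover have "{h \<in> topspace (weak_star smul). blinfun_apply h x \<in> ball c e} =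
      {h \<in> dual_space smul. norm (blinfun_apply h x - c) < e}"
    by (simp only: topspace_weak_star mem_ball dist_norm norm_minus_commute[of c])
  ultimately show ?thesis by simp
qed

lemma closedin_weak_star_le:
  "closedin (weak_star smul) {h \<in> dual_space smul. norm (blinfun_apply h x) \<le> r}"
proof -
  have "closedin (weak_star smul) {h \<in> topspace (weak_star smul). blinfun_apply h x \<in> cball 0 r}"
    by (intro closedin_continuous_map_preimage[OF continuous_map_weak_star_eval]) auto
  then show ?thesis by (simp add: topspace_weak_star)
qed

lemma compactin_weak_star_imp_bounded:
  assumes "compactin (weak_star smul) K"
  shows "bounded K"
proof (rule uniform_boundedness_principle)
  fix x
  have "compactin euclidean ((\<lambda>f. blinfun_apply f x) ` K)"
    using image_compactin[OF assms continuous_map_weak_star_eval] .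
  then show "bounded ((\<lambda>f. blinfun_apply f x) ` K)"
    by (simp add: compact_imp_bounded)
qed

lemma dual_space_smul: "f \<in> dual_space smul \<Longrightarrow> blinfun_apply f (smul c x) = c * blinfun_apply f x"
  unfolding dual_space_def Vector_Spaces.linear_def by (simp add: module_hom.scale)

section \<open>Monotonicity and compactness of Szlenk derivations\<close>

lemma szlenk_derivation_subset: "szlenk_derivation smul \<epsilon> A \<subseteq> A"
  by (auto simp: szlenk_derivation_def)

lemma szlenk_derivation_zero [simp]: "szlenk_derivation smul 0 A = A"
  by (simp add: szlenk_derivation_def)

text \<open>A weak*-neighbourhood has a larger trace on \<open>B\<close> than on \<open>A\<close>;
  boundedness of \<open>B\<close> ensures that \<open>diameter\<close> respects this
  inclusion.\<close>

lemma szlenk_derivation_mono: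
  assumes "A \<subseteq> B" "bounded B"
  shows "szlenk_derivation smul \<epsilon> A \<subseteq> szlenk_derivation smul \<epsilon> B"
proof -
  have "diameter (V \<inter> A) \<le> diameter (V \<inter> B)" for V
    using assms by (intro diameter_subset) auto
  then show ?thesis
    using assms(1) unfolding szlenk_derivation_def
    by (auto split: if_splits intro: less_le_trans)
qed

lemma foldr_szlenk_derivation_subset: "foldr (szlenk_derivation smul) es A \<subseteq> A"
proof (induction es)
  case (Cons e es)
  then show ?case using szlenk_derivation_subset by fastforce
qed simp

lemma foldr_szlenk_derivation_mono:
  assumes "A \<subseteq> B" "bounded B"
  shows "foldr (szlenk_derivation smul) es A \<subseteq> foldr (szlenk_derivation smul) es B"
proof (induction es)
  case Nil
  show ?case using assms(1) by simp
next
  case (Cons e es)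
  have "bounded (foldr (szlenk_derivation smul) es B)"
    by (rule bounded_subset[OF assms(2) foldr_szlenk_derivation_subset])
  with Cons show ?case using szlenk_derivation_mono by simp
qed

text \<open>Yields the easy implication of the theorem, with \<open>K\<close> as the smaller set and
  its hull as the larger one. The constant stays the same.\<close>

lemma summable_szlenk_index_mono:
  assumes "summable_szlenk_index smul B" "A \<subseteq> B" "bounded B"
  shows "summable_szlenk_index smul A"
  using assms(1) foldr_szlenk_derivation_mono[OF assms(2,3)]
  unfolding summable_szlenk_index_def M_summable_szlenk_index_def by blast

text \<open>The derivation removes from \<open>A\<close> the union of all open sets whose trace on
  \<open>A\<close> has diameter at most \<epsilon>, so what remains is a closed part of a compact
  set.\<close>

lemma compactin_szlenk_derivation:
  assumes "compactin (weak_star smul) A"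
  shows "compactin (weak_star smul) (szlenk_derivation smul \<epsilon> A)"
proof (cases "\<epsilon> \<le> 0")
  case True
  then show ?thesis using assms by (simp add: szlenk_derivation_def)
next
  case False
  let ?X = "weak_star smul"
  define U where "U = \<Union>{V. openin ?X V \<and> \<not> diameter (V \<inter> A) > \<epsilon>}"
  have "openin ?X U" unfolding U_def by (rule openin_Union) blast
  moreover have "szlenk_derivation smul \<epsilon> A = (topspace ?X - U) \<inter> A"
    using False compactin_subset_topspace[OF assms] unfolding szlenk_derivation_def U_def by auto
  ultimately show ?thesis
    using assms by (simp add: closed_Int_compactin openin_closedin_eq closedin_diff)
qed

lemma compactin_foldr_szlenk_derivation:
  assumes "compactin (weak_star smul) K"
  shows "compactin (weak_star smul) (foldr (szlenk_derivation smul) es K)"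
  using assms by (induction es) (simp_all add: compactin_szlenk_derivation)

section \<open>The game, and a strategy from a summable Szlenk index\<close>

text \<open>
  The first player, with \<open>n\<close> rounds left and \<open>x\<close> the sum of the vectors played so far, can ensure that
  the final sum is bounded by \<open>r\<close> on \<open>K\<close>.
\<close>

primrec sum_controlled ::
    "('k::real_or_complex_field \<Rightarrow> 'a::banach \<Rightarrow> 'a) \<Rightarrow> real \<Rightarrow> ('a \<Rightarrow>\<^sub>L 'k) set \<Rightarrow> nat \<Rightarrow> 'a \<Rightarrow> bool" where
  "sum_controlled smul r K 0 x \<longleftrightarrow> (\<forall>f\<in>K. norm (blinfun_apply f x) \<le> r)"
| "sum_controlled smul r K (Suc n) x \<longleftrightarrow>
     (\<exists>F. finite F \<and> F \<subseteq> dual_space smul \<and>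
       (\<forall>y. norm y \<le> 1 \<and> (\<forall>g\<in>F. norm (blinfun_apply g y) \<le> 1) \<longrightarrow> sum_controlled smul r K n (x + y)))"

text \<open>The set of functionals enters the game only through the final test, so sets that pass
  the same tests are interchangeable. This carries the strategy from \<open>K\<close> to its
  hull.\<close>

lemma sum_controlled_cong:
  assumes "\<And>x. (\<forall>f\<in>K. norm (blinfun_apply f x) \<le> r) \<longleftrightarrow> (\<forall>f\<in>L. norm (blinfun_apply f x) \<le> r)"
  shows "sum_controlled smul r K n x \<longleftrightarrow> sum_controlled smul r L n x"
  by (induction n arbitrary: x) (simp_all add: assms)

text \<open>
  Only derivations of order \<open>k \<eta>\<close> with \<open>k \<le> N\<close> are used, so that the weak neighbourhood that the first
  player chooses depends on finitely many weak*-compact sets.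
\<close>

lemma sum_controlled_of_derivations:
  fixes K :: "('a::banach \<Rightarrow>\<^sub>L 'k::real_or_complex_field) set"
  assumes K: "compactin (weak_star smul) K" and M: "M_summable_szlenk_index smul M K"
    and \<eta>: "\<eta> > 0" and N: "N * \<eta> > M"
    and D: "D = (\<lambda>k. real k * \<eta>) ` {..N}"
    and bound: "\<And>cs f. \<lbrakk>set cs \<subseteq> D; length cs = n; f \<in> foldr (szlenk_derivation smul) cs K\<rbrakk>
      \<Longrightarrow> norm (blinfun_apply f x) + sum_list cs + 3 * real n * \<eta> \<le> r"
  shows "sum_controlled smul r K n x"
  using bound
proof (induction n arbitrary: x)
  case 0
  then show ?case by force
next
  case (Suc n)
  let ?X = "weak_star smul"
  let ?A = "\<lambda>cs. foldr (szlenk_derivation smul) cs K"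
  let ?L = "{cs. set cs \<subseteq> D \<and> length cs = n}"
  have sum_nonneg: "0 \<le> sum_list cs" if "set cs \<subseteq> D" for cs
    using that \<eta> D by (intro sum_list_nonneg) force
  have bdK: "bounded K" by (rule compactin_weak_star_imp_bounded[OF K])
  \<comment> \<open>The assumption \<open>bound\<close> is the invariant of the strategy: with
    \<open>n\<close> rounds left, it limits the value at \<open>x\<close> plus the orders already
    used, with a reserve of 3 \<eta> per round. To restore it after a round, the orders
    \<open>cs\<close> are preceded by one further order, adapted to each \<open>f\<close>.\<close>
  have nbhd: "\<exists>V. openin ?X V \<and> f \<in> V \<and>
      (\<forall>h\<in>V \<inter> ?A cs. \<forall>y. norm y \<le> 1 \<and> norm (blinfun_apply f y) \<le> \<eta> \<longrightarrow>
        norm (blinfun_apply h (x + y)) + sum_list cs + 3 * real n * \<eta> \<le> r)"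
    if cs: "cs \<in> ?L" and f: "f \<in> ?A cs" for cs f
  proof -
    let ?P = "\<lambda>k. f \<notin> szlenk_derivation smul (real k * \<eta>) (?A cs)"
    \<comment> \<open>As \<open>N * \<eta>\<close> exceeds \<open>M\<close>, a further derivation of
      this order leaves nothing.\<close>
    have "?P N"
    proof
      assume "f \<in> szlenk_derivation smul (real N * \<eta>) (?A cs)"
      then have "?A ((real N * \<eta>) # cs) \<noteq> {}" by auto
      then have "sum_list ((real N * \<eta>) # cs) \<le> M"
        using M unfolding M_summable_szlenk_index_def by blast
      with N sum_nonneg cs show False by force
    qed
    moreover have "\<not> ?P 0" using f by simp
    ultimately obtain k where k: "k < N" "\<not> ?P k" "?P (Suc k)"
      using ex_least_nat_less[of ?P N] by blast
    define c where "c = real k * \<eta>"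
    have f_dual: "f \<in> dual_space smul"
      using f foldr_szlenk_derivation_subset compactin_subset_topspace[OF K]
      by (metis subsetD topspace_weak_star)
    have Suc_c: "real (Suc k) * \<eta> = c + \<eta>" by (simp add: c_def algebra_simps)
    have "c \<ge> 0" using \<eta> by (simp add: c_def)
    have fx: "norm (blinfun_apply f x) + (c + sum_list cs) + 3 * real (Suc n) * \<eta> \<le> r"
    proof -
      have "c \<in> D" using k(1) by (auto simp: c_def D)
      then show ?thesis using Suc.prems[of "c # cs" f] k(2) cs by (simp add: c_def)
    qed
    obtain V where V: "openin ?X V" "f \<in> V" "diameter (V \<inter> ?A cs) \<le> c + \<eta>"
      using k(3) f \<open>c \<ge> 0\<close> \<eta> unfolding szlenk_derivation_def Suc_c
      by (auto split: if_splits simp: not_less)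
    define W where "W = V \<inter> {h \<in> dual_space smul. norm (blinfun_apply h x - blinfun_apply f x) < \<eta>}"
    have "openin ?X W" unfolding W_def by (intro openin_Int V(1) openin_weak_star_near)
    moreover have "f \<in> W" using V f_dual \<eta> by (simp add: W_def)
    moreover have "norm (blinfun_apply h (x + y)) + sum_list cs + 3 * real n * \<eta> \<le> r"
      if h: "h \<in> W \<inter> ?A cs" and y: "norm y \<le> 1" "norm (blinfun_apply f y) \<le> \<eta>" for h y
    proof -
      have "bounded (V \<inter> ?A cs)"
        using bounded_subset[OF bdK] foldr_szlenk_derivation_subset by (metis le_infI2)
      then have "dist h f \<le> diameter (V \<inter> ?A cs)"
        using h V f by (intro diameter_bounded_bound) (auto simp: W_def)
      then have hf: "norm (h - f) \<le> c + \<eta>" using V(3) by (simp add: dist_norm)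
      have "norm (blinfun_apply (h - f) y) \<le> norm (h - f) * norm y" by (rule norm_blinfun)
      also have "\<dots> \<le> norm (h - f)" using y by (simp add: mult_left_le)
      finally have 1: "norm (blinfun_apply (h - f) y) \<le> c + \<eta>" using hf by simp
      have 2: "norm (blinfun_apply h x - blinfun_apply f x) < \<eta>" using h by (simp add: W_def)
      \<comment> \<open>The summands are bounded by \<eta>, \<open>norm (f x)\<close>,
        \<open>c + \<eta>\<close> and \<eta>. The three \<eta> use up the reserve of this round, and
        \<open>c\<close> is paid for by the order \<open>c\<close> in the invariant for
        \<open>c # cs\<close>.\<close>
      have "blinfun_apply h (x + y) = (blinfun_apply h x - blinfun_apply f x) + blinfun_apply f x
          + blinfun_apply (h - f) y + blinfun_apply f y"
        by (simp add: blinfun.add_right blinfun.diff_left)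
      then have "norm (blinfun_apply h (x + y)) \<le> norm (blinfun_apply h x - blinfun_apply f x)
          + norm (blinfun_apply f x) + norm (blinfun_apply (h - f) y) + norm (blinfun_apply f y)"
        by (simp only:) (intro norm_triangle_le add_mono order_refl)
      then have "norm (blinfun_apply h (x + y)) \<le> norm (blinfun_apply f x) + c + 3 * \<eta>"
        using 1 2 y by linarith
      then show ?thesis using fx by (simp add: algebra_simps)
    qed
    ultimately show ?thesis by blast
  qed
  \<comment> \<open>By weak*-compactness of the derived set, smallness of \<open>y\<close> at
    finitely many centres \<open>f\<close> suffices for all \<open>h\<close> in it.\<close>
  have "\<exists>T. finite T \<and> T \<subseteq> ?A cs \<and> (\<forall>h\<in>?A cs. \<forall>y. norm y \<le> 1 \<and>
      (\<forall>f\<in>T. norm (blinfun_apply f y) \<le> \<eta>) \<longrightarrow>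
        norm (blinfun_apply h (x + y)) + sum_list cs + 3 * real n * \<eta> \<le> r)"
    if cs: "cs \<in> ?L" for cs
  proof -
    obtain V where V: "\<And>f. f \<in> ?A cs \<Longrightarrow> openin ?X (V f) \<and> f \<in> V f \<and>
      (\<forall>h\<in>V f \<inter> ?A cs. \<forall>y. norm y \<le> 1 \<and> norm (blinfun_apply f y) \<le> \<eta> \<longrightarrow>
        norm (blinfun_apply h (x + y)) + sum_list cs + 3 * real n * \<eta> \<le> r)"
      using nbhd[OF cs] by metis
    have "compactin ?X (?A cs)" by (rule compactin_foldr_szlenk_derivation[OF K])
    moreover have "\<forall>U\<in>V ` ?A cs. openin ?X U" "?A cs \<subseteq> \<Union>(V ` ?A cs)" using V by blast+
    ultimately obtain \<F> where \<F>: "finite \<F>" "\<F> \<subseteq> V ` ?A cs" "?A cs \<subseteq> \<Union>\<F>"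
      unfolding compactin_def by meson
    then obtain T where T: "T \<subseteq> ?A cs" "finite T" "\<F> = V ` T"
      by (meson finite_subset_image)
    then show ?thesis using \<F>(3) V by (intro exI[of _ T]) blast
  qed
  then have "\<exists>T. \<forall>cs\<in>?L. finite (T cs) \<and> T cs \<subseteq> ?A cs \<and>
    (\<forall>h\<in>?A cs. \<forall>y. norm y \<le> 1 \<and> (\<forall>f\<in>T cs. norm (blinfun_apply f y) \<le> \<eta>) \<longrightarrow>
        norm (blinfun_apply h (x + y)) + sum_list cs + 3 * real n * \<eta> \<le> r)"
    by (intro bchoice ballI)
  then obtain T where T: "\<And>cs. cs \<in> ?L \<Longrightarrow> finite (T cs) \<and> T cs \<subseteq> ?A cs \<and>
    (\<forall>h\<in>?A cs. \<forall>y. norm y \<le> 1 \<and> (\<forall>f\<in>T cs. norm (blinfun_apply f y) \<le> \<eta>) \<longrightarrow>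
        norm (blinfun_apply h (x + y)) + sum_list cs + 3 * real n * \<eta> \<le> r)"
    by blast
  \<comment> \<open>The factor \<open>1 / \<eta>\<close> turns the game's bound 1 into the bound
    \<eta> for each \<open>f\<close>. Finiteness holds because there are only finitely many lists of
    length \<open>n\<close> over \<open>D\<close>.\<close>
  define F where "F = (\<lambda>f. blinfun_mult_right (of_real (1 / \<eta>)) o\<^sub>L f) ` (\<Union>cs\<in>?L. T cs)"
  show ?case
    unfolding sum_controlled.simps
  proof (intro exI[of _ F] conjI allI impI)
    have "finite ?L" unfolding D by (rule finite_lists_length_eq) simp
    then show "finite F" unfolding F_def using T by blast
    show "F \<subseteq> dual_space smul"
    proof
      fix g assume "g \<in> F"
      then obtain f cs where f: "cs \<in> ?L" "f \<in> T cs" and g: "g = blinfun_mult_right (of_real (1 / \<eta>)) o\<^sub>L f"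
        unfolding F_def by blast
      have "f \<in> dual_space smul"
        using f T foldr_szlenk_derivation_subset compactin_subset_topspace[OF K]
        by (metis (no_types, lifting) subsetD topspace_weak_star)
      then show "g \<in> dual_space smul"
        unfolding g dual_space_def Vector_Spaces.linear_def module_hom_def
        by (auto simp: module_hom_axioms_def algebra_simps)
    qed
    fix y assume y: "norm y \<le> 1 \<and> (\<forall>g\<in>F. norm (blinfun_apply g y) \<le> 1)"
    have small: "norm (blinfun_apply f y) \<le> \<eta>" if "cs \<in> ?L" "f \<in> T cs" for f cs
    proof -
      have "norm (blinfun_apply (blinfun_mult_right (of_real (1 / \<eta>)) o\<^sub>L f) y) \<le> 1"
        using y that unfolding F_def by blast
      then show ?thesis using \<eta> by (simp add: norm_mult norm_divide field_simps)
    qed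
    show "sum_controlled smul r K n (x + y)"
      using T small y by (intro Suc.IH) blast
  qed
qed

text \<open>At \<open>x = 0\<close> the invariant only asks that the orders used, together with the
  total reserve, be at most \<open>M + 1\<close>. Summability bounds the orders by \<open>M\<close>,
  and \<eta> is chosen so that the reserve is at most 1.\<close>

lemma sum_controlled_of_M_summable:
  assumes "compactin (weak_star smul) K" "M_summable_szlenk_index smul M K" "M \<ge> 0"
  shows "sum_controlled smul (M + 1) K n 0"
proof -
  define \<eta> :: real where "\<eta> = 1 / (3 * real n + 1)"
  have \<eta>: "\<eta> > 0" "3 * real n * \<eta> \<le> 1" by (auto simp: \<eta>_def field_simps)
  obtain N :: nat where N: "M < real N * \<eta>" using reals_Archimedean3[OF \<eta>(1)] by blast
  show ?thesis
  proof (rule sum_controlled_of_derivations[OF assms(1,2) \<eta>(1) N refl])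
    fix cs f
    assume "f \<in> foldr (szlenk_derivation smul) cs K"
    then have "sum_list cs \<le> M" using assms(2) unfolding M_summable_szlenk_index_def by blast
    then show "norm (blinfun_apply f 0) + sum_list cs + 3 * real n * \<eta> \<le> M + 1"
      using \<eta> by simp
  qed
qed

section \<open>From a strategy back to a summable Szlenk index\<close>

text \<open>Near \<open>f\<close> there are \<open>u\<close> and \<open>v\<close> in
  \<open>A\<close> more than \<epsilon> apart, hence a unit vector \<open>z\<close> at which they
  differ by more than \<epsilon>. As \<open>z\<close> may be large on \<open>F\<close>, a net point
  \<open>w\<close> at which \<open>u\<close> and \<open>v\<close> nearly agree is subtracted.
  Halving the difference and choosing the better of \<open>u\<close> and \<open>v\<close> accounts
  for \<open>\<epsilon> / 4\<close>.\<close>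

lemma szlenk_derivation_perturb:
  fixes A F :: "('a::banach \<Rightarrow>\<^sub>L 'k::real_or_complex_field) set"
  assumes f: "f \<in> szlenk_derivation smul \<epsilon> A" and "\<epsilon> > 0"
    and A: "bounded A" "A \<subseteq> dual_space smul" and F: "finite F" and \<eta>: "\<eta> > 0"
  obtains h y where "h \<in> A" "norm y \<le> 1" "\<And>g. g \<in> F \<Longrightarrow> norm (blinfun_apply g y) \<le> 1"
    "norm (blinfun_apply h x - blinfun_apply f x) < \<eta>" "norm (blinfun_apply h y) \<ge> \<epsilon> / 4 - \<eta> / 2"
proof -
  let ?X = "weak_star smul"
  obtain Z where Z: "finite Z" "\<And>z. z \<in> Z \<Longrightarrow> norm z \<le> 1"
    "\<And>z. norm z \<le> 1 \<Longrightarrow> \<exists>w\<in>Z. \<forall>g\<in>F. norm (blinfun_apply g (z - w)) \<le> 2"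
    using finite_unit_ball_net[OF F] by blast
  define U where "U z = {h \<in> dual_space smul. norm (blinfun_apply h z - blinfun_apply f z) < \<eta>}" for z
  \<comment> \<open>The vector \<open>z\<close>, and with it \<open>w\<close>, depends on
    \<open>V\<close>; therefore \<open>V\<close> controls the values at all points of the finite net
    in advance.\<close>
  define V where "V = \<Inter>(U ` insert x Z)"
  have "f \<in> A" using f szlenk_derivation_subset by blast
  have "openin ?X V"
    unfolding V_def using Z(1) by (intro openin_Inter) (auto simp: U_def openin_weak_star_near)
  moreover have "f \<in> V" using \<open>f \<in> A\<close> A \<eta> by (auto simp: V_def U_def)
  ultimately have "diameter (V \<inter> A) > \<epsilon>"
    using f \<open>\<epsilon> > 0\<close> unfolding szlenk_derivation_def by (auto split: if_splits)
  moreover have "bounded (V \<inter> A)" using A by auto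
  ultimately obtain u v where uv: "u \<in> V \<inter> A" "v \<in> V \<inter> A" "\<epsilon> < dist u v"
    using diameter_lower_bounded \<open>\<epsilon> > 0\<close> by blast
  then have "\<not> norm (u - v) \<le> \<epsilon>" by (simp add: dist_norm)
  then obtain z0 where z0: "norm (blinfun_apply (u - v) z0) > \<epsilon> * norm z0"
    using norm_blinfun_bound \<open>\<epsilon> > 0\<close> by (metis less_imp_le not_le)
  then have "z0 \<noteq> 0" by auto
  define z where "z = z0 /\<^sub>R norm z0"
  have z: "norm z = 1" "norm (blinfun_apply (u - v) z) > \<epsilon>"
    using z0 \<open>z0 \<noteq> 0\<close> by (auto simp: z_def blinfun.scaleR_right field_simps)
  then obtain w where w: "w \<in> Z" "\<forall>g\<in>F. norm (blinfun_apply g (z - w)) \<le> 2" using Z(3)[of z] by auto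
  define y where "y = (1/2) *\<^sub>R (z - w)"
  have y1: "norm y \<le> 1"
    using norm_triangle_ineq4[of z w] z Z(2)[OF w(1)] by (simp add: y_def)
  have yF: "norm (blinfun_apply g y) \<le> 1" if "g \<in> F" for g
    using w that by (simp add: y_def blinfun.scaleR_right)
  have near: "norm (blinfun_apply h t - blinfun_apply f t) < \<eta>"
    if "h \<in> {u, v}" "t \<in> {x, w}" for h t
    using that uv w by (auto simp: V_def U_def)
  have "blinfun_apply (u - v) w =
      (blinfun_apply u w - blinfun_apply f w) - (blinfun_apply v w - blinfun_apply f w)"
    by (simp add: blinfun.diff_left)
  then have uvw: "norm (blinfun_apply (u - v) w) < 2 * \<eta>"
    using norm_triangle_ineq4[of "blinfun_apply u w - blinfun_apply f w" "blinfun_apply v w - blinfun_apply f w"]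
      near[of u w] near[of v w] by simp
  \<comment> \<open>Here \<open>z = w + 2 y\<close>. The part at \<open>w\<close> is below
    \<open>2 * \<eta>\<close>, so \<open>u\<close> and \<open>v\<close> share more than
    \<open>\<epsilon> / 2 - \<eta>\<close> at \<open>y\<close>.\<close>
  have "blinfun_apply (u - v) z = blinfun_apply (u - v) w + (2 *\<^sub>R blinfun_apply u y - 2 *\<^sub>R blinfun_apply v y)"
    by (simp add: y_def blinfun.diff_right blinfun.diff_left blinfun.scaleR_right algebra_simps)
  then have "norm (blinfun_apply (u - v) z) \<le> norm (blinfun_apply (u - v) w)
      + (norm (2 *\<^sub>R blinfun_apply u y) + norm (2 *\<^sub>R blinfun_apply v y))"
    by (simp only:) (intro norm_triangle_le add_left_mono norm_triangle_ineq4)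
  then have "\<epsilon> < 2 * \<eta> + 2 * norm (blinfun_apply u y) + 2 * norm (blinfun_apply v y)"
    using z(2) uvw by simp
  then have "\<exists>h\<in>{u, v}. norm (blinfun_apply h y) \<ge> \<epsilon> / 4 - \<eta> / 2"
    by (simp; linarith)
  then obtain h where "h \<in> {u, v}" "norm (blinfun_apply h y) \<ge> \<epsilon> / 4 - \<eta> / 2" by blast
  then show thesis using that[of h y] y1 yF near[of h x] uv by auto
qed

text \<open>For nonzero \<open>a\<close> and \<open>b\<close>, \<open>c\<close> is the quotient of
  their phases, so that \<open>c * b\<close> points in the direction of \<open>a\<close>. It
  prevents the gain of a new round from cancelling the earlier ones.\<close>

lemma exists_aligning_scalar:
  fixes a b :: "'k::real_normed_field"
  shows "\<exists>c. norm c = 1 \<and> norm (a + c * b) = norm a + norm b"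
proof (cases "a = 0 \<or> b = 0")
  case True
  then show ?thesis by (intro exI[of _ 1]) auto
next
  case False
  define c where "c = (a / of_real (norm a)) * (of_real (norm b) / b)"
  have "norm c = 1" using False by (simp add: c_def norm_mult norm_divide)
  moreover have "a + c * b = (a / of_real (norm a)) * of_real (norm a + norm b)"
    using False by (simp add: c_def field_simps)
  then have "norm (a + c * b) = norm a + norm b"
    using False by (simp add: norm_mult norm_divide del: of_real_add)
  ultimately show ?thesis by blast
qed

text \<open>Induction on the list: the head is the derivation applied last, so undoing it moves from
  \<open>f\<close> to a nearby \<open>h\<close> in the preceding derived set. The second player
  answers with the vector from \<open>szlenk_derivation_perturb\<close>, rotated so that the values
  at \<open>x\<close> and at the new vector add up in norm.\<close>

lemma sum_controlled_imp_sum_list_le: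
  fixes L :: "('a::banach \<Rightarrow>\<^sub>L 'k::real_or_complex_field) set"
  assumes smul: "banach_space_over smul" and L: "bounded L" "L \<subseteq> dual_space smul"
    and "sum_controlled smul r L (length es) x" "f \<in> foldr (szlenk_derivation smul) es L"
  shows "norm (blinfun_apply f x) + sum_list es / 5 \<le> r"
  using assms(4,5)
proof (induction es arbitrary: f x)
  case Nil
  then show ?case by simp
next
  case (Cons \<epsilon> es)
  let ?A = "foldr (szlenk_derivation smul) es L"
  obtain F where F: "finite F" "F \<subseteq> dual_space smul"
    "\<And>y. norm y \<le> 1 \<Longrightarrow> \<forall>g\<in>F. norm (blinfun_apply g y) \<le> 1 \<Longrightarrow> sum_controlled smul r L (length es) (x + y)"
    using Cons.prems(1) by auto
  have f: "f \<in> szlenk_derivation smul \<epsilon> ?A" using Cons.prems(2) by simp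
  show ?case
  proof (cases "\<epsilon> > 0")
    case False
    \<comment> \<open>For a nonpositive order the second player passes by playing 0, and the term
      \<open>\<epsilon> / 5\<close> cannot increase the left-hand side.\<close>
    then have "f \<in> ?A" using f szlenk_derivation_subset by blast
    then show ?thesis using Cons.IH[of x f] F(3)[of 0] False by (simp add: add_divide_distrib)
  next
    case True
    have A: "bounded ?A" "?A \<subseteq> dual_space smul"
      using L foldr_szlenk_derivation_subset by (blast intro: bounded_subset)+
    \<comment> \<open>With tolerance \<open>\<epsilon> / 40\<close> the net gain of the round is at
      least \<open>\<epsilon> / 4 - \<epsilon> / 80 - \<epsilon> / 40 = 17 \<epsilon> / 80\<close>,
      which exceeds \<open>\<epsilon> / 5\<close>.\<close>
    have "\<epsilon> / 40 > 0" using True by simp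
    then obtain h y where h: "h \<in> ?A" "norm y \<le> 1" "\<And>g. g \<in> F \<Longrightarrow> norm (blinfun_apply g y) \<le> 1"
      "norm (blinfun_apply h x - blinfun_apply f x) < \<epsilon> / 40"
      "norm (blinfun_apply h y) \<ge> \<epsilon> / 4 - \<epsilon> / 40 / 2"
      by (rule szlenk_derivation_perturb[OF f True A F(1)]) blast
    obtain c where c: "norm c = 1"
      "norm (blinfun_apply h x + c * blinfun_apply h y) = norm (blinfun_apply h x) + norm (blinfun_apply h y)"
      using exists_aligning_scalar by blast
    have "norm (smul c y) \<le> 1"
      using h(2) c(1) banach_space_over.norm_smul[OF smul, of c y] by simp
    \<comment> \<open>Rotation by \<open>c\<close> stays within the chosen neighbourhood because the
      members of \<open>F\<close> are linear over the scalar field.\<close>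
    moreover have "\<forall>g\<in>F. norm (blinfun_apply g (smul c y)) \<le> 1"
      using h(3) F(2) c(1) by (auto simp: dual_space_smul norm_mult subset_iff)
    ultimately have "sum_controlled smul r L (length es) (x + smul c y)" by (rule F(3))
    then have "norm (blinfun_apply h (x + smul c y)) + sum_list es / 5 \<le> r"
      using h(1) by (rule Cons.IH)
    moreover have "norm (blinfun_apply h (x + smul c y)) = norm (blinfun_apply h x) + norm (blinfun_apply h y)"
      using c(2) h(1) A(2) by (simp add: blinfun.add_right dual_space_smul subset_iff)
    moreover have "norm (blinfun_apply f x) \<le> norm (blinfun_apply h x) + \<epsilon> / 40"
      using h(4) norm_triangle_sub[of "blinfun_apply f x" "blinfun_apply h x"]
      by (simp add: norm_minus_commute)
    ultimately show ?thesis using h(5) True by (simp add: field_simps)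
  qed
qed

section \<open>The weak*-closed absolutely convex hull\<close>

lemma absolutely_convex_dual_space_le:
  fixes smul :: "'k::real_or_complex_field \<Rightarrow> 'a::banach \<Rightarrow> 'a"
  shows "absolutely_convex {h \<in> dual_space smul. norm (blinfun_apply h x) \<le> r}"
  unfolding absolutely_convex_def
proof
  let ?S = "{h \<in> dual_space smul. norm (blinfun_apply h x) \<le> r}"
  show "convex ?S"
  proof (rule convexI)
    fix f g :: "'a \<Rightarrow>\<^sub>L 'k" and u v :: real
    assume f: "f \<in> ?S" and g: "g \<in> ?S" and uv: "0 \<le> u" "0 \<le> v" "u + v = 1"
    have "norm (blinfun_apply (u *\<^sub>R f + v *\<^sub>R g) x)
        \<le> u * norm (blinfun_apply f x) + v * norm (blinfun_apply g x)"
      using uv norm_triangle_ineq[of "u *\<^sub>R blinfun_apply f x" "v *\<^sub>R blinfun_apply g x"]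
      by (simp add: blinfun.add_left blinfun.scaleR_left)
    also have "\<dots> \<le> r" using f g uv by (intro convex_bound_le) auto
    finally have "norm (blinfun_apply (u *\<^sub>R f + v *\<^sub>R g) x) \<le> r" .
    moreover have "u *\<^sub>R f + v *\<^sub>R g \<in> dual_space smul"
      using f g unfolding dual_space_def Vector_Spaces.linear_def module_hom_def
      by (auto simp: module_hom_axioms_def blinfun.add_left blinfun.scaleR_left algebra_simps)
    ultimately show "u *\<^sub>R f + v *\<^sub>R g \<in> ?S" by simp
  qed
  show "balanced ?S"
    unfolding balanced_def
  proof (intro allI ballI impI)
    fix c :: 'k and f assume f: "f \<in> ?S" and c: "norm c \<le> 1"
    have "norm (blinfun_apply (blinfun_mult_right c o\<^sub>L f) x) \<le> r"
      using f c mult_right_mono[OF c, of "norm (blinfun_apply f x)"] by (simp add: norm_mult)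
    moreover have "blinfun_mult_right c o\<^sub>L f \<in> dual_space smul"
      using f unfolding dual_space_def Vector_Spaces.linear_def module_hom_def
      by (auto simp: module_hom_axioms_def algebra_simps)
    ultimately show "blinfun_mult_right c o\<^sub>L f \<in> ?S" by simp
  qed
qed

text \<open>The bounding set is both weak*-closed and absolutely convex. Hence passing to the hull
  does not raise the supremum at any \<open>x\<close>.\<close>

lemma weak_star_closed_abs_co_le:
  assumes "K \<subseteq> {h \<in> dual_space smul. norm (blinfun_apply h x) \<le> r}"
  shows "weak_star_closed_abs_co smul K \<subseteq> {h \<in> dual_space smul. norm (blinfun_apply h x) \<le> r}"
  unfolding weak_star_closed_abs_co_def
  by (intro closure_of_minimal hull_minimal assms closedin_weak_star_le absolutely_convex_dual_space_le)

lemma subset_weak_star_closed_abs_co: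
  assumes "K \<subseteq> dual_space smul"
  shows "K \<subseteq> weak_star_closed_abs_co smul K"
proof -
  have "K \<subseteq> topspace (weak_star smul) \<inter> (absolutely_convex hull K)"
    using assms hull_subset[of K absolutely_convex] by (simp add: topspace_weak_star)
  also have "\<dots> \<subseteq> weak_star_closed_abs_co smul K"
    unfolding weak_star_closed_abs_co_def by (rule closure_of_subset_Int)
  finally show ?thesis .
qed

lemma weak_star_closed_abs_co_subset_dual_space: "weak_star_closed_abs_co smul K \<subseteq> dual_space smul"
  unfolding weak_star_closed_abs_co_def
  using closure_of_subset_topspace topspace_weak_star by metis

text \<open>The pointwise bounds \<open>R * norm x\<close> pass to the hull for each
  \<open>x\<close> separately and together give the norm bound \<open>R\<close>.\<close>

lemma bounded_weak_star_closed_abs_co: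
  assumes "bounded K" "K \<subseteq> dual_space smul"
  shows "bounded (weak_star_closed_abs_co smul K)"
proof -
  obtain R where R: "R > 0" "\<And>f. f \<in> K \<Longrightarrow> norm f \<le> R"
    using assms(1) unfolding bounded_pos by blast
  have "norm (blinfun_apply f x) \<le> R * norm x" if "f \<in> K" for f x
    using norm_blinfun[of f x] mult_right_mono[OF R(2)[OF that], of "norm x"] by simp
  then have "weak_star_closed_abs_co smul K \<subseteq>
      {h \<in> dual_space smul. norm (blinfun_apply h x) \<le> R * norm x}" for x
    using assms(2) by (intro weak_star_closed_abs_co_le) auto
  then have "norm h \<le> R" if "h \<in> weak_star_closed_abs_co smul K" for h
    using that R(1) by (intro norm_blinfun_bound) auto
  then show ?thesis unfolding bounded_iff by blast
qed

section \<open>The equivalence\<close>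

theorem theorem1p1:
  fixes smul :: "'k::real_or_complex_field \<Rightarrow> 'a::banach \<Rightarrow> 'a"
    and K :: "('a \<Rightarrow>\<^sub>L 'k) set"
  assumes "banach_space_over smul"
    and "compactin (weak_star smul) K"
  shows "summable_szlenk_index smul K \<longleftrightarrow>
         summable_szlenk_index smul (weak_star_closed_abs_co smul K)"
proof
  let ?L = "weak_star_closed_abs_co smul K"
  have K: "bounded K" "K \<subseteq> dual_space smul"
    using compactin_weak_star_imp_bounded[OF assms(2)] compactin_subset_topspace[OF assms(2)]
    by (simp_all add: topspace_weak_star)
  have L: "bounded ?L" "?L \<subseteq> dual_space smul" "K \<subseteq> ?L"
    by (rule bounded_weak_star_closed_abs_co[OF K] weak_star_closed_abs_co_subset_dual_space
        subset_weak_star_closed_abs_co[OF K(2)])+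
  show "summable_szlenk_index smul K" if "summable_szlenk_index smul ?L"
    using that L(3,1) by (rule summable_szlenk_index_mono)
  assume "summable_szlenk_index smul K"
  then obtain M where M: "M \<ge> 0" "M_summable_szlenk_index smul M K"
    unfolding summable_szlenk_index_def by blast
  have le_iff: "(\<forall>f\<in>K. norm (blinfun_apply f x) \<le> M + 1) \<longleftrightarrow> (\<forall>f\<in>?L. norm (blinfun_apply f x) \<le> M + 1)" for x
    using weak_star_closed_abs_co_le[of K smul x "M + 1"] K(2) L(3) by blast
  \<comment> \<open>The bound \<open>M + 1\<close> is the same for every number of rounds, so it
    serves lists of orders of every length.\<close>
  have L_controlled: "sum_controlled smul (M + 1) ?L n 0" for n
    using sum_controlled_of_M_summable[OF assms(2) M(2,1)]
    by (simp only: sum_controlled_cong[OF le_iff])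
  \<comment> \<open>The game starts at 0, where \<open>f\<close> vanishes, so only the accumulated
    gain \<open>sum_list es / 5\<close> remains below \<open>M + 1\<close>.\<close>
  have "sum_list es \<le> 5 * (M + 1)" if "foldr (szlenk_derivation smul) es ?L \<noteq> {}" for es
  proof -
    from that obtain f where "f \<in> foldr (szlenk_derivation smul) es ?L" by blast
    then show ?thesis
      using sum_controlled_imp_sum_list_le[OF assms(1) L(1,2) L_controlled] by fastforce
  qed
  then show "summable_szlenk_index smul ?L"
    unfolding summable_szlenk_index_def M_summable_szlenk_index_def
    using M(1) by (intro exI[of _ "5 * (M + 1)"]) auto
qed

end
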